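(* The set $\mathcal N$ of nuclear partitions produces the entire set $\mathcal P$ of integer partitions by the decay process. That is, for every $n\geq 0$, every non-nuclear partition of $n$ is produced by the decay of some nuclear partition of $n$.
   Context: $\mathcal P$ denotes the set of integer partitions. A nuclear partition is an integer partition with no part equal to $1$; $\mathcal N\subset\mathcal P$ denotes the set of nuclear partitions. A partition having at least one part equal to $1$ is called non-nuclear. Decay process: a nuclear partition $\mu=(\mu_1,\mu_2,\dots,\mu_r)$ of $n$, $\mu_1\geq\mu_2\geq\dots\geq\mu_r\geq 2$, other than the one-part partition $(n)$, decays into the $\mu_1-\mu_2$ non-nuclear partitions of $n$ obtained by decreasing the largest part $\mu_1$ by a positive integer $j\leq\mu_1-\mu_2$ and adjoining $j$ parts equal to $1$ (if $\mu_1-\mu_2=0$, then $\mu$ is in the "ground state" and does not decay). The one-part nuclear partition $(n)$ decays into the $n-1$ non-nuclear partitions $(n)\to(n-1,1)\to(n-2,1,1)\to\dots\to(1,1,1,\dots,1)$.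
   Formalization: The case n = 1 is excluded: the partition (1) is non-nuclear but there is no nuclear partition of 1 to decay into it, so the nuclear partitions produce all integer partitions except (1). *)

theory Defs
  imports Main
begin

text \<open>An integer partition is the list of its parts in weakly decreasing order; the empty list
  is the partition of \<open>0\<close>.\<close>

definition int_partitions :: "nat list set" where
  "int_partitions = {p. sorted_wrt (\<ge>) p \<and> (\<forall>i \<in> set p. i \<ge> 1)}"

definition nuclear_partitions :: "nat list set" where
  "nuclear_partitions = {p \<in> int_partitions. 1 \<notin> set p}"

definition non_nuclear_partitions :: "nat list set" where
  "non_nuclear_partitions = {p \<in> int_partitions. 1 \<in> set p}"

text \<open>The bound on \<open>j\<close> keeps the list in decreasing order, so no re-sorting is needed.
  The empty partition does not decay.
  Decay preserves the sum and there is no nuclear partition of \<open>1\<close>, so nothing decays into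
  the non-nuclear partition \<open>[1]\<close>.\<close>

inductive decays :: "nat list \<Rightarrow> nat list \<Rightarrow> bool" where
  several_parts: "decays (m1 # m2 # ms) ((m1 - j) # m2 # ms @ replicate j 1)"
    if "m1 # m2 # ms \<in> nuclear_partitions" "1 \<le> j" "j \<le> m1 - m2"
| one_part: "decays [n] ((n - j) # replicate j 1)"
    if "[n] \<in> nuclear_partitions" "1 \<le> j" "j \<le> n - 1"

end

theory Submission
  imports Defs
begin

text \<open>The decay is inverted by fusing all parts equal to 1 into the largest part. For the partition
  \<open>1 + \<dots> + 1\<close> of \<open>n\<close>, whose largest part is itself a 1, the result is \<open>(n)\<close>, which is nuclear
  unless \<open>n = 1\<close>.\<close>

text \<open>Weak decrease pushes the parts equal to 1 to the end of the list, so they form a single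
  block that can be cut off and later fused.\<close>

lemma nuclear_ones_decomposition:
  assumes "p \<in> int_partitions"
  obtains q k where "q \<in> nuclear_partitions" "p = q @ replicate k 1"
proof -
  have "\<exists>q k. q \<in> nuclear_partitions \<and> p = q @ replicate k 1"
    using assms
  proof (induction p)
    case Nil
    then show ?case by (auto simp: nuclear_partitions_def)
  next
    case (Cons a p)
    then have a: "a \<ge> 1" "\<forall>i\<in>set p. 1 \<le> i \<and> i \<le> a" and p: "p \<in> int_partitions"
      by (auto simp: int_partitions_def)
    show ?case
    proof (cases "a = 1")
      case True
      \<comment> \<open>The head bounds every later part, so a leading 1 forces all parts to be 1
        and the nuclear prefix is empty.\<close>
      with a(2) have "p = replicate (length p) 1"
        by (metis le_antisym replicate_length_same)
      with True have "a # p = [] @ replicate (Suc (length p)) 1"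
        by simp
      moreover have "[] \<in> nuclear_partitions"
        by (simp add: nuclear_partitions_def int_partitions_def)
      ultimately show ?thesis by blast
    next
      case False
      obtain q k where q: "q \<in> nuclear_partitions" "p = q @ replicate k 1"
        using Cons.IH p by blast
      with a False have "a # q \<in> nuclear_partitions"
        by (auto simp: nuclear_partitions_def int_partitions_def)
      with q(2) show ?thesis by (metis append_Cons)
    qed
  qed
  with that show thesis by blast
qed

lemma decays_sum_list: "decays m p \<Longrightarrow> sum_list p = sum_list m"
  by (induction rule: decays.induct) (auto simp: sum_list_replicate)

lemma sorted_wrt_replicate_ge: "sorted_wrt (\<ge>) (replicate k (a::nat))"
  by (induction k) auto

lemma decays_int_partition: "decays m p \<Longrightarrow> p \<in> int_partitions"
proof (induction rule: decays.induct)
  case (several_parts m1 m2 ms j)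
  then show ?case
    by (auto simp: nuclear_partitions_def int_partitions_def sorted_wrt_append
      sorted_wrt_replicate_ge)
next
  case (one_part n j)
  then show ?case
    by (auto simp: int_partitions_def sorted_wrt_replicate_ge)
qed

text \<open>Since \<open>j \<ge> 1\<close>, at least one part is adjoined behind the reduced largest
  part, so every product has two or more parts.\<close>

lemma decays_neq_singleton_one: "decays m p \<Longrightarrow> p \<noteq> [1]"
  by (induction rule: decays.induct) auto

lemma non_nuclear_decay_product:
  assumes "p \<in> non_nuclear_partitions" "p \<noteq> [1]"
  shows "\<exists>m\<in>nuclear_partitions. decays m p"
proof -
  from assms(1) obtain q k where q: "q \<in> nuclear_partitions" and p: "p = q @ replicate k 1"
    using nuclear_ones_decomposition unfolding non_nuclear_partitions_def by blast
  with assms(1) have k: "k \<ge> 1"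
    by (cases k) (auto simp: non_nuclear_partitions_def nuclear_partitions_def)
  \<comment> \<open>Fusing keeps the number of parts of \<open>q\<close>, unless \<open>q\<close> is
    empty and a 1 must act as the largest part; the count selects the decay rule.\<close>
  consider "q = []" | a where "q = [a]" | a b r where "q = a # b # r"
    by (metis neq_Nil_conv)
  then show ?thesis
  proof cases
    case 1
    with assms(2) p k have k2: "k \<ge> 2"
      by (cases "k = 1") auto
    then have m: "[k] \<in> nuclear_partitions"
      by (simp add: nuclear_partitions_def int_partitions_def)
    \<comment> \<open>One of the \<open>k\<close> ones is what remains of the largest part, so only
      \<open>k - 1\<close> ones are split off.\<close>
    have "decays [k] ((k - (k - 1)) # replicate (k - 1) 1)"
      using m k2 by (intro decays.one_part) auto
    moreover have "(k - (k - 1)) # replicate (k - 1) 1 = p"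
      using 1 p k by (cases k) auto
    ultimately show ?thesis using m by metis
  next
    case (2 a)
    with q k have m: "[a + k] \<in> nuclear_partitions" and "a \<ge> 1"
      by (auto simp: nuclear_partitions_def int_partitions_def)
    then have "decays [a + k] ((a + k - k) # replicate k 1)"
      using k by (intro decays.one_part) auto
    with 2 p m show ?thesis by auto
  next
    case (3 a b r)
    \<comment> \<open>The inequality \<open>b \<le> a\<close> is what makes \<open>j = k\<close>
      admissible: it gives \<open>k \<le> (a + k) - b\<close>.\<close>
    with q k have m: "(a + k) # b # r \<in> nuclear_partitions" and "b \<le> a"
      by (auto simp: nuclear_partitions_def int_partitions_def)
    then have "decays ((a + k) # b # r) ((a + k - k) # b # r @ replicate k 1)"
      using k by (intro decays.several_parts) auto
    with 3 p m show ?thesis by auto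
  qed
qed

theorem mainTheorem3:
  "nuclear_partitions \<union> {p. \<exists>m \<in> nuclear_partitions. decays m p} = int_partitions - {[1]} \<and>
   (\<forall>n. n \<noteq> 1 \<longrightarrow>
     (\<forall>p \<in> non_nuclear_partitions. sum_list p = n \<longrightarrow>
       (\<exists>m \<in> nuclear_partitions. sum_list m = n \<and> decays m p)))"
proof (intro conjI allI impI ballI equalityI subsetI)
  fix p assume "p \<in> nuclear_partitions \<union> {p. \<exists>m \<in> nuclear_partitions. decays m p}"
  then show "p \<in> int_partitions - {[1]}"
    using decays_int_partition decays_neq_singleton_one
    by (auto simp: nuclear_partitions_def)
next
  fix p assume "p \<in> int_partitions - {[1]}"
  then show "p \<in> nuclear_partitions \<union> {p. \<exists>m \<in> nuclear_partitions. decays m p}"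
    using non_nuclear_decay_product[of p]
    by (auto simp: nuclear_partitions_def non_nuclear_partitions_def)
next
  fix n p assume "n \<noteq> 1" "p \<in> non_nuclear_partitions" "sum_list p = n"
  \<comment> \<open>The condition \<open>n \<noteq> 1\<close> excludes \<open>p = [1]\<close>, and
    \<open>m\<close> has sum \<open>n\<close> because decay preserves the sum.\<close>
  then show "\<exists>m \<in> nuclear_partitions. sum_list m = n \<and> decays m p"
    using non_nuclear_decay_product[of p] decays_sum_list by fastforce
qed

end
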